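(* Let $Q$ and $\tilde Q$ be stochastic matrices on a finite set $\mathcal V$, let $\mu$ be a probability vector on $\mathcal V$, and let $\beta\in(0,1)$. Let $\mathcal W:=\mathrm{supp}(\tilde Q-Q)$ and suppose $\mu(\mathcal W)<1$. Let $\pi$ be the unique invariant probability vector of $P:=(1-\beta)Q+\beta\mathbf 1\mu$ (equivalently, the unique solution of $\pi=(1-\beta)\pi Q+\beta\mu$), and let $\tilde\pi$ be the unique invariant probability vector of $\tilde P:=(1-\beta)\tilde Q+\beta\mathbf 1\mu$ (equivalently, the unique solution of $\tilde\pi=(1-\beta)\tilde\pi\tilde Q+\beta\mu$). Then $$\|\tilde\pi-\pi\|\le\Psi\left(\frac{(1+\beta)\,\pi(\mathcal W)}{\beta^2(1-\mu(\mathcal W))}\right).$$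
   Context: A probability vector is a nonnegative row vector indexed by $\mathcal V$ with entries summing to $1$; a stochastic matrix is a nonnegative square matrix indexed by $\mathcal V$ with all row sums equal to $1$. A probability vector $\nu$ is invariant for $P$ if $\nu P=\nu$. $\mathbf 1$ is the all-one column vector. For a matrix $A$, $\mathrm{supp}(A):=\{v\in\mathcal V: A_{v,\cdot}\neq0\}$ is the set of (indices of) its nonzero rows. For a probability vector $\nu$ and $\mathcal W\subseteq\mathcal V$, $\nu(\mathcal W):=\sum_{w\in\mathcal W}\nu_w$. The total variation distance is $\|\nu-\nu'\|:=\frac12\sum_{v\in\mathcal V}|\nu_v-\nu'_v|$. The function $\Psi:[0,+\infty)\to[0,1]$ is defined by $\Psi(x)=x\ln(e^2/x)$ for $x\le x^*$ (with $\Psi(0)=0$) and $\Psi(x)=1$ for $x>x^*$, where $x^*=0.31784\ldots$ is the smallest positive solution of $x\ln(e^2/x)=1$. ($\pi$ is the (personalized) PageRank vector associated with $Q$, $\mu$, $\beta$, and $\tilde\pi$ is the one obtained after altering the rows of $Q$ indexed by $\mathcal W$.) *)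

theory Defs
  imports "HOL-Analysis.Analysis"
begin

text \<open>Vectors and matrices indexed by the finite set of vertices are elements of
  \<open>real ^ 'n\<close> and \<open>real ^ 'n ^ 'n\<close>; \<open>x v* A\<close> is the product of the row vector \<open>x\<close> with \<open>A\<close>.\<close>

definition prob_vector :: "real ^ 'n::finite \<Rightarrow> bool" where
  "prob_vector \<nu> \<longleftrightarrow> (\<forall>v. 0 \<le> \<nu> $ v) \<and> (\<Sum>v\<in>UNIV. \<nu> $ v) = 1"

definition stochastic_matrix :: "real ^ 'n ^ 'n::finite \<Rightarrow> bool" where
  "stochastic_matrix A \<longleftrightarrow> (\<forall>u v. 0 \<le> A $ u $ v) \<and> (\<forall>u. (\<Sum>v\<in>UNIV. A $ u $ v) = 1)"

definition invariant_for :: "real ^ 'n::finite \<Rightarrow> real ^ 'n ^ 'n \<Rightarrow> bool" where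
  "invariant_for \<nu> P \<longleftrightarrow> \<nu> v* P = \<nu>"

definition row_supp :: "real ^ 'n ^ 'm::finite \<Rightarrow> 'm set" where
  "row_supp A = {v. row v A \<noteq> 0}"

definition mass :: "real ^ 'n::finite \<Rightarrow> 'n set \<Rightarrow> real" where
  "mass \<nu> W = (\<Sum>w\<in>W. \<nu> $ w)"

definition tv_dist :: "real ^ 'n::finite \<Rightarrow> real ^ 'n \<Rightarrow> real" where
  "tv_dist \<nu> \<nu>' = 1 / 2 * (\<Sum>v\<in>UNIV. \<bar>\<nu> $ v - \<nu>' $ v\<bar>)"

text \<open>The all-one column vector times the row vector \<open>\<mu>\<close> is the matrix all of whose
  rows equal \<open>\<mu>\<close>.\<close>

definition pagerank_matrix :: "real ^ 'n ^ 'n::finite \<Rightarrow> real \<Rightarrow> real ^ 'n \<Rightarrow> real ^ 'n ^ 'n" where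
  "pagerank_matrix Q \<beta> \<mu> = (1 - \<beta>) *\<^sub>R Q + \<beta> *\<^sub>R (\<chi> u v. \<mu> $ v)"

text \<open>The minimum exists, see \<open>x_star_least\<close> below.\<close>

definition x_star :: real where
  "x_star = (LEAST x. 0 < x \<and> x * ln ((exp 1)\<^sup>2 / x) = 1)"

text \<open>Only arguments \<open>x \<ge> 0\<close> are meaningful. At \<open>0\<close> the first branch has the value \<open>0\<close>.\<close>

definition Psi :: "real \<Rightarrow> real" where
  "Psi x = (if x \<le> x_star then x * ln ((exp 1)\<^sup>2 / x) else 1)"

lemma x_ln_eq: "x * ln ((exp 1)\<^sup>2 / x) = x * (2 - ln x)" if "0 < x" for x :: real
  using that by (simp add: ln_div ln_realpow)

lemma x_star_least:
  shows "0 < x_star" "x_star < 1" "x_star * ln ((exp 1)\<^sup>2 / x_star) = 1"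
    and "\<And>x. 0 < x \<Longrightarrow> x * ln ((exp 1)\<^sup>2 / x) = 1 \<Longrightarrow> x_star \<le> x"
proof -
  define f where "f = (\<lambda>x::real. x * (2 - ln x))"
  have mono: "f x < f y" if "0 < x" "x < y" "y \<le> 1" for x y
  proof (rule DERIV_pos_imp_increasing[OF \<open>x < y\<close>])
    fix z assume z: "x \<le> z" "z \<le> y"
    then have "(f has_real_derivative (1 - ln z)) (at z)"
      unfolding f_def using that by (auto intro!: derivative_eq_intros)
    moreover have "ln z \<le> 0"
      using z that by simp
    ultimately show "\<exists>d. (f has_real_derivative d) (at z) \<and> 0 < d"
      by (intro exI[of _ "1 - ln z"]) auto
  qed
  have "f (exp (- 3)) \<le> 1"
  proof -
    have "5 \<le> (1 + 1 / real 2 * 3) ^ 2" by (simp add: power2_eq_square)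
    also have "\<dots> \<le> exp 3" using exp_ge_one_plus_x_over_n_power_n[of 2 3] by simp
    finally show ?thesis unfolding f_def ln_exp by (simp add: exp_minus field_simps)
  qed
  moreover have "f 1 = 2" by (simp add: f_def)
  moreover have "continuous_on {exp (- 3)..1} f"
    unfolding f_def by (intro continuous_intros) (auto dest: less_le_trans[OF exp_gt_zero])
  ultimately obtain a where a: "exp (- 3) \<le> a" "a \<le> 1" "f a = 1"
    using IVT'[of f "exp (- 3)" 1 1] by auto
  have a0: "0 < a" using a(1) exp_gt_zero less_le_trans by blast
  have a1: "a < 1" using a \<open>f 1 = 2\<close> by (cases "a = 1") auto
  have least: "a \<le> x" if "0 < x" "x * ln ((exp 1)\<^sup>2 / x) = 1" for x
    using mono[of x a] that a(2,3) x_ln_eq[of x] by (force simp: f_def)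
  have aeq: "a * ln ((exp 1)\<^sup>2 / a) = 1"
    using a(3) x_ln_eq[OF a0] by (simp add: f_def)
  have "x_star = a"
    unfolding x_star_def using a0 aeq least by (intro Least_equality) auto
  then show "0 < x_star" "x_star < 1" "x_star * ln ((exp 1)\<^sup>2 / x_star) = 1"
    and "\<And>x. 0 < x \<Longrightarrow> x * ln ((exp 1)\<^sup>2 / x) = 1 \<Longrightarrow> x_star \<le> x"
    using a0 a1 aeq least by auto
qed

lemma Psi_0: "Psi 0 = 0"
  using x_star_least(1) by (simp add: Psi_def)

lemma prob_vector_mult_pagerank_matrix:
  assumes "(\<Sum>v\<in>UNIV. \<nu> $ v) = 1"
  shows "\<nu> v* pagerank_matrix Q \<beta> \<mu> = (1 - \<beta>) *\<^sub>R (\<nu> v* Q) + \<beta> *\<^sub>R \<mu>"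
proof -
  have "(\<Sum>u\<in>UNIV. \<nu> $ u * (\<beta> * c)) = \<beta> * c" for c
    using assms by (simp flip: sum_distrib_right)
  then show ?thesis
    by (simp add: vec_eq_iff pagerank_matrix_def vector_matrix_mult_def distrib_left
        sum.distrib sum_distrib_left mult.left_commute)
qed

lemma sum_mult_stochastic:
  assumes "stochastic_matrix Q"
  shows "(\<Sum>v\<in>UNIV. (\<nu> v* Q) $ v) = (\<Sum>v\<in>UNIV. \<nu> $ v)"
proof -
  have "(\<Sum>v\<in>UNIV. (\<nu> v* Q) $ v) = (\<Sum>u\<in>UNIV. \<Sum>v\<in>UNIV. \<nu> $ u * Q $ u $ v)"
    unfolding vector_matrix_mult_def vec_lambda_beta by (rule sum.swap)
  also have "\<dots> = (\<Sum>u\<in>UNIV. \<nu> $ u)"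
    using assms by (simp add: stochastic_matrix_def flip: sum_distrib_left)
  finally show ?thesis .
qed

lemma l1_mult_stochastic:
  assumes "stochastic_matrix Q"
  shows "(\<Sum>v\<in>UNIV. \<bar>(\<nu> v* Q) $ v\<bar>) \<le> (\<Sum>v\<in>UNIV. \<bar>\<nu> $ v\<bar>)"
proof -
  have "(\<Sum>v\<in>UNIV. \<bar>(\<nu> v* Q) $ v\<bar>) \<le> (\<Sum>v\<in>UNIV. \<Sum>u\<in>UNIV. \<bar>\<nu> $ u\<bar> * Q $ u $ v)"
    unfolding vector_matrix_mult_def vec_lambda_beta
    by (intro sum_mono order_trans[OF sum_abs])
      (use assms in \<open>auto simp: abs_mult stochastic_matrix_def\<close>)
  also have "\<dots> = (\<Sum>v\<in>UNIV. ((\<chi> u. \<bar>\<nu> $ u\<bar>) v* Q) $ v)"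
    by (simp add: vector_matrix_mult_def)
  also have "\<dots> = (\<Sum>u\<in>UNIV. \<bar>\<nu> $ u\<bar>)"
    using sum_mult_stochastic[OF assms] by simp
  finally show ?thesis .
qed

lemma pagerank_equation_unique:
  assumes "stochastic_matrix Q" "0 < \<beta>" "\<beta> < 1"
    and x: "x = (1 - \<beta>) *\<^sub>R (x v* Q) + \<beta> *\<^sub>R \<mu>"
    and y: "y = (1 - \<beta>) *\<^sub>R (y v* Q) + \<beta> *\<^sub>R \<mu>"
  shows "x = y"
proof -
  let ?n = "\<lambda>z. \<Sum>v\<in>UNIV. \<bar>z $ v\<bar>"
  have "x - y = (1 - \<beta>) *\<^sub>R ((x - y) v* Q)"
    by (subst x, subst y) (simp add: vector_matrix_mult_diff_distrib scaleR_diff_right)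
  then have "?n (x - y) = ?n ((1 - \<beta>) *\<^sub>R ((x - y) v* Q))"
    by simp
  also have "\<dots> = (1 - \<beta>) * ?n ((x - y) v* Q)"
    using assms by (simp add: abs_mult sum_distrib_left)
  also have "\<dots> \<le> (1 - \<beta>) * ?n (x - y)"
    using assms(3) l1_mult_stochastic[OF assms(1), of "x - y"] by (intro mult_left_mono) simp_all
  finally have "\<beta> * ?n (x - y) \<le> 0"
    by (simp add: algebra_simps)
  then have "?n (x - y) \<le> 0"
    using assms by (simp add: mult_le_0_iff)
  moreover have "0 \<le> ?n (x - y)"
    by (intro sum_nonneg) simp
  ultimately have "?n (x - y) = 0"
    by linarith
  then show ?thesis
    by (simp add: sum_nonneg_eq_0_iff vec_eq_iff)
qed

lemma pagerank_exists:
  fixes Q :: "real ^ 'n ^ 'n::finite"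
  assumes "stochastic_matrix Q" "prob_vector \<mu>" "0 < \<beta>" "\<beta> < 1"
  shows "\<exists>\<pi>. prob_vector \<pi> \<and> invariant_for \<pi> (pagerank_matrix Q \<beta> \<mu>)"
proof -
  let ?S = "Collect prob_vector :: (real ^ 'n) set"
  let ?f = "\<lambda>\<nu>. (1 - \<beta>) *\<^sub>R (\<nu> v* Q) + \<beta> *\<^sub>R \<mu>"
  have "closed ?S"
    unfolding prob_vector_def by (intro closed_Collect_conj closed_Collect_all
        closed_Collect_le closed_Collect_eq continuous_intros)
  moreover have "?S \<subseteq> cball 0 1"
  proof
    fix \<nu> assume "\<nu> \<in> ?S"
    then have "(\<Sum>v\<in>UNIV. \<bar>\<nu> $ v\<bar>) = 1" by (simp add: prob_vector_def)
    then show "\<nu> \<in> cball 0 1" using norm_le_l1_cart[of \<nu>] by simp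
  qed
  ultimately have "compact ?S"
    using bounded_cball bounded_subset compact_eq_bounded_closed by blast
  moreover have "convex ?S"
    by (rule convexI) (auto simp: prob_vector_def sum.distrib simp flip: sum_distrib_left)
  moreover have "?S \<noteq> {}"
    using assms by blast
  moreover have "continuous_on ?S ?f"
    unfolding vector_matrix_mult_def by (intro continuous_intros)
  moreover have "?f \<in> ?S \<rightarrow> ?S"
  proof
    fix \<nu> assume \<nu>: "\<nu> \<in> ?S"
    have "0 \<le> (\<nu> v* Q) $ v" for v
      using \<nu> assms(1) by (auto simp: vector_matrix_mult_def prob_vector_def
          stochastic_matrix_def intro!: sum_nonneg)
    moreover have "(\<Sum>v\<in>UNIV. (\<nu> v* Q) $ v) = 1"
      using \<nu> sum_mult_stochastic[OF assms(1)] by (simp add: prob_vector_def)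
    ultimately show "?f \<nu> \<in> ?S"
      using assms by (auto simp: prob_vector_def sum.distrib simp flip: sum_distrib_left)
  qed
  ultimately obtain \<pi> where "\<pi> \<in> ?S" "?f \<pi> = \<pi>"
    using brouwer[of ?S ?f] by blast
  then show ?thesis
    using prob_vector_mult_pagerank_matrix[of \<pi> Q \<beta> \<mu>]
    by (auto simp: invariant_for_def prob_vector_def)
qed

lemma pagerank_iff_equation:
  assumes "stochastic_matrix Q" "prob_vector \<mu>" "0 < \<beta>" "\<beta> < 1"
  shows "prob_vector \<pi> \<and> invariant_for \<pi> (pagerank_matrix Q \<beta> \<mu>)
    \<longleftrightarrow> \<pi> = (1 - \<beta>) *\<^sub>R (\<pi> v* Q) + \<beta> *\<^sub>R \<mu>"
proof -
  have *: "\<nu> = (1 - \<beta>) *\<^sub>R (\<nu> v* Q) + \<beta> *\<^sub>R \<mu>"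
    if "prob_vector \<nu> \<and> invariant_for \<nu> (pagerank_matrix Q \<beta> \<mu>)" for \<nu>
    using that prob_vector_mult_pagerank_matrix[of \<nu> Q \<beta> \<mu>]
    by (auto simp: invariant_for_def prob_vector_def)
  then show ?thesis
    using pagerank_exists[OF assms] pagerank_equation_unique[OF assms(1,3,4)] by metis
qed

lemma pagerank_ex1:
  assumes "stochastic_matrix Q" "prob_vector \<mu>" "0 < \<beta>" "\<beta> < 1"
  shows "\<exists>!\<pi>. prob_vector \<pi> \<and> invariant_for \<pi> (pagerank_matrix Q \<beta> \<mu>)"
  using pagerank_exists[OF assms] pagerank_iff_equation[OF assms]
    pagerank_equation_unique[OF assms(1,3,4)] by metis

end

(* Subtracting the two PageRank equations gives
   \<pi>' - \<pi> = (1 - \<beta>) (\<pi>' - \<pi>) Q' + (1 - \<beta>) \<pi> (Q' - Q). As Q' contracts the l1 norm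
   and only the rows in W contribute to the last term, the total variation distance is
   at most (1 - \<beta>) \<pi>(W) / \<beta>. This linear bound is already stronger than the claim,
   because y \<le> Psi y for y \<le> x_star. *)
theory Submission
  imports Defs
begin

lemma mass_nonneg:
  assumes "prob_vector \<nu>"
  shows "0 \<le> mass \<nu> W"
  using assms by (auto simp: mass_def prob_vector_def intro: sum_nonneg)

text \<open>This settles the range where \<open>Psi\<close> is constantly 1. Nonnegativity bounds
  each absolute difference by the sum of the two entries, and these sums total 2.\<close>

lemma tv_dist_le_1:
  assumes "prob_vector \<nu>" "prob_vector \<nu>'"
  shows "tv_dist \<nu> \<nu>' \<le> 1"
proof -
  have "(\<Sum>v\<in>UNIV. \<bar>\<nu> $ v - \<nu>' $ v\<bar>) \<le> (\<Sum>v\<in>UNIV. \<nu> $ v + \<nu>' $ v)"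
  proof (rule sum_mono)
    fix v
    have "0 \<le> \<nu> $ v" "0 \<le> \<nu>' $ v"
      using assms by (auto simp: prob_vector_def)
    then show "\<bar>\<nu> $ v - \<nu>' $ v\<bar> \<le> \<nu> $ v + \<nu>' $ v"
      by linarith
  qed
  also have "\<dots> = 2"
    using assms by (simp add: prob_vector_def sum.distrib)
  finally show ?thesis
    by (simp add: tv_dist_def)
qed

text \<open>Since \<open>x_star\<close> < 1, the logarithm of a positive x is at most 0 here, so the
  factor 2 - ln x of \<open>Psi x\<close> exceeds 1. The point 0 is separate because
  \<open>x_ln_eq\<close> needs x > 0.\<close>

lemma le_Psi:
  assumes "0 \<le> x" "x \<le> x_star"
  shows "x \<le> Psi x"
proof (cases "x = 0")
  case True
  then show ?thesis by (simp add: Psi_0)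
next
  case False
  then have "0 < x" "ln x \<le> 0"
    using assms x_star_least(2) by auto
  then have "x * 1 \<le> x * (2 - ln x)"
    by (intro mult_left_mono) linarith+
  then show ?thesis
    using assms \<open>0 < x\<close> by (simp add: Psi_def x_ln_eq)
qed

text \<open>Rows that agree cancel, so \<nu> can be restricted to the support of Q' - Q without
  changing the product. The restricted vector is then pushed through Q and Q' separately; each image
  has l1 norm at most its mass, whence the factor 2.\<close>

lemma l1_mult_stochastic_diff:
  assumes "stochastic_matrix Q" "stochastic_matrix Q'" "prob_vector \<nu>"
  shows "(\<Sum>v\<in>UNIV. \<bar>(\<nu> v* (Q' - Q)) $ v\<bar>) \<le> 2 * mass \<nu> (row_supp (Q' - Q))"
proof -
  let ?W = "row_supp (Q' - Q)"
  define \<omega> where "\<omega> = (\<chi> u. if u \<in> ?W then \<nu> $ u else 0)"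
  have eq: "(\<nu> v* (Q' - Q)) $ v = (\<omega> v* Q') $ v - (\<omega> v* Q) $ v" for v
  proof -
    have "\<nu> $ u * (Q' $ u $ v - Q $ u $ v) = \<omega> $ u * Q' $ u $ v - \<omega> $ u * Q $ u $ v" for u
      by (auto simp: \<omega>_def row_supp_def row_def vec_eq_iff right_diff_distrib)
    then show ?thesis
      by (simp add: vector_matrix_mult_def mult.commute sum_subtractf)
  qed
  have l1: "(\<Sum>u\<in>UNIV. \<bar>\<omega> $ u\<bar>) = mass \<nu> ?W"
  proof -
    have "(\<Sum>u\<in>UNIV. \<bar>\<omega> $ u\<bar>) = (\<Sum>u\<in>UNIV. if u \<in> ?W then \<nu> $ u else 0)"
      using assms(3) by (intro sum.cong) (auto simp: \<omega>_def prob_vector_def)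
    then show ?thesis
      by (simp add: mass_def flip: sum.inter_filter)
  qed
  have "(\<Sum>v\<in>UNIV. \<bar>(\<nu> v* (Q' - Q)) $ v\<bar>)
      \<le> (\<Sum>v\<in>UNIV. \<bar>(\<omega> v* Q') $ v\<bar> + \<bar>(\<omega> v* Q) $ v\<bar>)"
    unfolding eq by (intro sum_mono abs_triangle_ineq4)
  also have "\<dots> \<le> 2 * mass \<nu> ?W"
    using l1_mult_stochastic[OF assms(1), of \<omega>] l1_mult_stochastic[OF assms(2), of \<omega>] l1
    by (simp add: sum.distrib)
  finally show ?thesis .
qed

lemma tv_dist_pagerank_le:
  assumes "stochastic_matrix Q" "stochastic_matrix Q'" "0 < \<beta>" "\<beta> < 1" "prob_vector \<pi>"
    and \<pi>: "\<pi> = (1 - \<beta>) *\<^sub>R (\<pi> v* Q) + \<beta> *\<^sub>R \<mu>"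
    and \<pi>': "\<pi>' = (1 - \<beta>) *\<^sub>R (\<pi>' v* Q') + \<beta> *\<^sub>R \<mu>"
  shows "tv_dist \<pi>' \<pi> \<le> (1 - \<beta>) * mass \<pi> (row_supp (Q' - Q)) / \<beta>"
proof -
  let ?n = "\<lambda>z. \<Sum>v\<in>UNIV. \<bar>z $ v\<bar>"
  let ?m = "mass \<pi> (row_supp (Q' - Q))"
  define d where "d = \<pi>' - \<pi>"
  define e where "e = \<pi> v* (Q' - Q)"
  \<comment> \<open>The mixed term \<open>\<pi> v* Q'\<close> is inserted, so that the perturbation
    \<open>e\<close> involves only the unperturbed vector \<pi>.\<close>
  have "\<pi>' v* Q' - \<pi> v* Q = d v* Q' + e"
    by (simp add: vec_eq_iff d_def e_def vector_matrix_mult_def algebra_simps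
        sum.distrib sum_subtractf)
  moreover have "d = (1 - \<beta>) *\<^sub>R (\<pi>' v* Q' - \<pi> v* Q)"
    unfolding d_def by (subst \<pi>, subst \<pi>') (simp add: scaleR_diff_right)
  ultimately have "d = (1 - \<beta>) *\<^sub>R (d v* Q' + e)"
    by simp
  then have "?n d = ?n ((1 - \<beta>) *\<^sub>R (d v* Q' + e))"
    by simp
  also have "\<dots> = (1 - \<beta>) * ?n (d v* Q' + e)"
    using assms by (simp add: abs_mult sum_distrib_left)
  also have "\<dots> \<le> (1 - \<beta>) * (?n (d v* Q') + ?n e)"
    using assms(4) by (intro mult_left_mono)
      (auto simp flip: sum.distrib intro!: sum_mono abs_triangle_ineq)
  also have "\<dots> \<le> (1 - \<beta>) * (?n d + 2 * ?m)"
    using assms(4) l1_mult_stochastic[OF assms(2), of d]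
      l1_mult_stochastic_diff[OF assms(1,2,5)]
    unfolding e_def by (intro mult_left_mono add_mono) auto
  \<comment> \<open>Absorbing (1 - \<beta>) \<open>?n d\<close> on the left leaves the factor
    \<beta>; the 2 cancels against the 1/2 in \<open>tv_dist\<close>.\<close>
  finally have "\<beta> * ?n d \<le> 2 * ((1 - \<beta>) * ?m)"
    by (simp add: algebra_simps)
  then show ?thesis
    using assms(3) by (simp add: tv_dist_def d_def field_simps)
qed

theorem mainTheorem2:
  fixes Q Q' :: "real ^ 'n ^ 'n::finite"
    and \<mu> \<pi> \<pi>' :: "real ^ 'n"
    and \<beta> :: real
    and W :: "'n set"
  assumes "stochastic_matrix Q"
    and "stochastic_matrix Q'"
    and "prob_vector \<mu>"
    and "0 < \<beta>" and "\<beta> < 1"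
    and "W = row_supp (Q' - Q)"
    and "mass \<mu> W < 1"
    and "prob_vector \<pi>" and "invariant_for \<pi> (pagerank_matrix Q \<beta> \<mu>)"
    and "prob_vector \<pi>'" and "invariant_for \<pi>' (pagerank_matrix Q' \<beta> \<mu>)"
  shows "tv_dist \<pi>' \<pi> \<le> Psi ((1 + \<beta>) * mass \<pi> W / (\<beta>\<^sup>2 * (1 - mass \<mu> W)))"
proof -
  define x where "x = (1 + \<beta>) * mass \<pi> W / (\<beta>\<^sup>2 * (1 - mass \<mu> W))"
  have m: "0 \<le> mass \<pi> W" "0 \<le> mass \<mu> W"
    using assms(3,8) by (simp_all add: mass_nonneg)
  have "tv_dist \<pi>' \<pi> \<le> Psi x"
  proof (cases "x \<le> x_star")
    case True
    have "tv_dist \<pi>' \<pi> \<le> (1 - \<beta>) * mass \<pi> W / \<beta>"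
      unfolding assms(6)
      using tv_dist_pagerank_le[OF assms(1,2,4,5,8)] pagerank_iff_equation assms(1-5,8-11)
      by blast
    also have "\<dots> \<le> (1 + \<beta>) * mass \<pi> W / (\<beta>\<^sup>2 * (1 - mass \<mu> W))"
    \<comment> \<open>The numerator grows because 1 - \<beta> \<le> 1 + \<beta>. The denominator
      shrinks, since \<beta> and 1 - \<mu>(W) are at most 1, and stays positive because \<mu>(W) <
      1.\<close>
    proof (intro frac_le mult_right_mono)
      have "\<beta> * (\<beta> * (1 - mass \<mu> W)) \<le> \<beta> * 1"
        using assms(4,5,7) m by (intro mult_left_mono mult_le_one) auto
      then show "\<beta>\<^sup>2 * (1 - mass \<mu> W) \<le> \<beta>"
        by (simp add: power2_eq_square mult.assoc)
    qed (use assms(4,5,7) m in auto)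
    also have "\<dots> \<le> Psi x"
    proof -
      have "0 \<le> x"
        using assms(4,7) m by (simp add: x_def)
      then show ?thesis
        using le_Psi[OF _ True] by (simp add: x_def)
    qed
    finally show ?thesis .
  next
    case False
    \<comment> \<open>Beyond \<open>x_star\<close> the claim is the trivial bound by 1.\<close>
    then show ?thesis
      using tv_dist_le_1[OF assms(10,8)] by (simp add: Psi_def)
  qed
  then show ?thesis
    by (simp add: x_def)
qed

end
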